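(* Let $X$ and $Y$ be two non-negative random variables, with quantile and density functions $F^{-1}$, $f$ and $G^{-1}$, $g$, respectively, where the quantile functions are differentiable. Assume that there exists a point $p^*\in(0,1)$ such that $f(F^{-1}(p))/g(G^{-1}(p))$ is increasing over $(0,p^* )$ and decreasing over $(p^*,1)$. Define $$\delta(p)=F^{-1}(p)\,\frac{f(F^{-1}(p))}{g(G^{-1}(p))}-G^{-1}(p),\qquad p\in(0,1).$$ Then: 1. $X\le_\star Y$ if, and only if, $\lim_{p\to0^+}\delta(p)\ge0$ and $\lim_{p\to1^-}\delta(p)\ge0$. 2. $X\ge_\star Y$ if, and only if, $\delta(p^* )\le0$.
   Context: Standing assumptions: $X$ and $Y$ are non-negative, have finite expectation, distribution functions $F$ and $G$, density functions $f$ and $g$, and interval supports $(l_X,u_X)$ and $(l_Y,u_Y)$ (bounded or unbounded). The quantile function is $F^{-1}(p)=\inf\{x\in\mathbb R: F(x)\ge p\}$, $p\in(0,1)$, and similarly for $G^{-1}$; quantile functions are differentiable on $(0,1)$ with $\frac{d}{dp}F^{-1}(p)=1/f(F^{-1}(p))$ and $\frac{d}{dp}G^{-1}(p)=1/g(G^{-1}(p))$. "Increasing" and "decreasing" are used in the non-strict sense. $p^*$ is the mode (relative maximum point) of $f(F^{-1}(p))/g(G^{-1}(p))$. Limits are taken in the extended reals. Star-shaped order: $X\le_\star Y$ means that $G^{-1}(p)/F^{-1}(p)$ is increasing in $p\in(0,1)$; $X\ge_\star Y$ means $Y\le_\star X$. *)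

theory Defs
  imports "HOL-Probability.Probability"
begin

abbreviation dist_fun :: "'a measure \<Rightarrow> ('a \<Rightarrow> real) \<Rightarrow> real \<Rightarrow> real" where
  "dist_fun M X \<equiv> cdf (distr M borel X)"

definition quantile :: "'a measure \<Rightarrow> ('a \<Rightarrow> real) \<Rightarrow> real \<Rightarrow> real" where
  "quantile M X p = Inf {x. p \<le> dist_fun M X x}"

definition law_support :: "'a measure \<Rightarrow> ('a \<Rightarrow> real) \<Rightarrow> real set" where
  "law_support M X = {x. \<forall>U. open U \<longrightarrow> x \<in> U \<longrightarrow> 0 < measure (distr M borel X) U}"

text \<open>
  Standing assumptions on a random variable \<open>X\<close> with density \<open>f\<close> and interval support with
  (possibly infinite) end points \<open>l\<close> and \<open>u\<close>. The topological support is a closed set, so having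
  the open interval as support is expressed through its closure; the values of \<open>f\<close> outside the
  interval and at its end points are left free. In the last clause the formula for the derivative
  of the quantile function tacitly includes that its denominator does not vanish; this has to be
  said explicitly since \<open>1 / 0 = 0\<close> in HOL.
\<close>

definition standing_assms ::
    "'a measure \<Rightarrow> ('a \<Rightarrow> real) \<Rightarrow> (real \<Rightarrow> real) \<Rightarrow> ereal \<Rightarrow> ereal \<Rightarrow> bool" where
  "standing_assms M X f l u \<longleftrightarrow>
     prob_space M \<and>
     (AE \<omega> in M. 0 \<le> X \<omega>) \<and>
     integrable M X \<and>
     (\<forall>x. 0 \<le> f x) \<and>
     distributed M lborel X (\<lambda>x. ennreal (f x)) \<and>
     l < u \<and>
     law_support M X = closure {x. l < ereal x \<and> ereal x < u} \<and>
     (\<forall>p\<in>{0<..<1}. 0 < f (quantile M X p) \<and>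
        (quantile M X has_real_derivative 1 / f (quantile M X p)) (at p))"

definition star_le ::
    "'a measure \<Rightarrow> ('a \<Rightarrow> real) \<Rightarrow> 'b measure \<Rightarrow> ('b \<Rightarrow> real) \<Rightarrow> bool" where
  "star_le M X N Y \<longleftrightarrow> mono_on {0<..<1} (\<lambda>p. quantile N Y p / quantile M X p)"

end

theory Submission
  imports Defs
begin

text \<open>
  Write \<open>A\<close>, \<open>B\<close> for the quantile functions of \<open>X\<close>, \<open>Y\<close> and \<open>r = B' / A'\<close> for the density ratio, so
  that \<open>\<delta> = A r - B\<close> and \<open>(B / A)' = A' \<delta> / A\<^sup>2\<close>: the star-shaped orders are sign conditions on \<open>\<delta>\<close>.
  By Cauchy's mean value theorem \<open>B q - B p = r c (A q - A p)\<close> for some \<open>c\<close> between \<open>p\<close> and \<open>q\<close>, and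
  therefore \<open>\<delta>\<close> inherits the monotonicity of \<open>r\<close> on either side of \<open>p\<^sup>*\<close>. Since \<open>r\<close> is, up to the
  change of variable \<open>A\<close>, a derivative, it cannot jump at \<open>p\<^sup>*\<close>, so both monotonicity intervals may
  be closed up at \<open>p\<^sup>*\<close>. Hence \<open>\<delta>\<close> is largest at \<open>p\<^sup>*\<close> and bounded below by its limits at \<open>0\<close> and \<open>1\<close>.
\<close>

section \<open>One-sided limits of monotone functions, and derivative criteria for
  monotonicity\<close>

text \<open>Completeness of the order supplies the infimum even for values unbounded below, as
  needed for \<open>ereal\<close>. Naming the limit as an infimum lets a lower bound on it be read
  as a lower bound on all values.\<close>

lemma mono_on_tendsto_at_right_INF:
  fixes h :: "real \<Rightarrow> 'a::{complete_linorder, linorder_topology}"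
  assumes "a < b" and mono: "mono_on {a<..<b} h"
  shows "(h \<longlongrightarrow> (INF x\<in>{a<..<b}. h x)) (at_right a)"
proof (rule order_tendstoI)
  fix y assume y: "y < (INF x\<in>{a<..<b}. h x)"
  have "y < h x" if "x \<in> {a<..<b}" for x
    using y INF_lower[OF that, of h] by order
  then show "\<forall>\<^sub>F x in at_right a. y < h x"
    using \<open>a < b\<close> unfolding eventually_at_right_field by auto
next
  fix y assume "(INF x\<in>{a<..<b}. h x) < y"
  then obtain z where z: "z \<in> {a<..<b}" "h z < y"
    by (auto simp: INF_less_iff)
  have "h x < y" if "a < x" "x < z" for x
    using mono_onD[OF mono, of x z] that z by fastforce
  then show "\<forall>\<^sub>F x in at_right a. h x < y"
    using z unfolding eventually_at_right_field by auto
qed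

lemma antimono_on_tendsto_at_left_INF:
  fixes h :: "real \<Rightarrow> 'a::{complete_linorder, linorder_topology}"
  assumes "a < b" and anti: "antimono_on {a<..<b} h"
  shows "(h \<longlongrightarrow> (INF x\<in>{a<..<b}. h x)) (at_left b)"
proof (rule order_tendstoI)
  fix y assume y: "y < (INF x\<in>{a<..<b}. h x)"
  have "y < h x" if "x \<in> {a<..<b}" for x
    using y INF_lower[OF that, of h] by order
  then show "\<forall>\<^sub>F x in at_left b. y < h x"
    using \<open>a < b\<close> unfolding eventually_at_left_field by auto
next
  fix y assume "(INF x\<in>{a<..<b}. h x) < y"
  then obtain z where z: "z \<in> {a<..<b}" "h z < y"
    by (auto simp: INF_less_iff)
  have "h x < y" if "z < x" "x < b" for x
    using monotone_onD[OF anti, of z x] that z by fastforce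
  then show "\<forall>\<^sub>F x in at_left b. h x < y"
    using z unfolding eventually_at_left_field by auto
qed

lemma mono_on_iff_deriv_nonneg:
  fixes h h' :: "real \<Rightarrow> real"
  assumes deriv: "\<And>x. x \<in> {a<..<b} \<Longrightarrow> (h has_real_derivative h' x) (at x)"
  shows "mono_on {a<..<b} h \<longleftrightarrow> (\<forall>x\<in>{a<..<b}. 0 \<le> h' x)"
proof
  assume "mono_on {a<..<b} h"
  then show "\<forall>x\<in>{a<..<b}. 0 \<le> h' x"
    using deriv by (auto intro!: mono_on_imp_deriv_nonneg)
next
  assume nonneg: "\<forall>x\<in>{a<..<b}. 0 \<le> h' x"
  show "mono_on {a<..<b} h"
  proof (rule mono_onI)
    fix x y assume xy: "x \<in> {a<..<b}" "y \<in> {a<..<b}" "x \<le> y"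
    show "h x \<le> h y"
    proof (rule DERIV_nonneg_imp_nondecreasing[OF \<open>x \<le> y\<close>])
      fix z assume "x \<le> z" "z \<le> y"
      then have "z \<in> {a<..<b}"
        using xy by auto
      then show "\<exists>d. (h has_real_derivative d) (at z) \<and> 0 \<le> d"
        using deriv nonneg by blast
    qed
  qed
qed

lemma mono_on_divide_iff:
  fixes P Q P' Q' :: "real \<Rightarrow> real"
  assumes "\<And>x. x \<in> {a<..<b} \<Longrightarrow> (P has_real_derivative P' x) (at x)"
    and "\<And>x. x \<in> {a<..<b} \<Longrightarrow> (Q has_real_derivative Q' x) (at x)"
    and pos: "\<And>x. x \<in> {a<..<b} \<Longrightarrow> 0 < Q x"
  shows "mono_on {a<..<b} (\<lambda>x. P x / Q x) \<longleftrightarrow> (\<forall>x\<in>{a<..<b}. 0 \<le> P' x * Q x - P x * Q' x)"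
proof -
  have "((\<lambda>x. P x / Q x) has_real_derivative (P' x * Q x - P x * Q' x) / (Q x * Q x)) (at x)"
    if "x \<in> {a<..<b}" for x
    using assms(1,2)[OF that] pos[OF that] by (intro DERIV_divide) auto
  then have "mono_on {a<..<b} (\<lambda>x. P x / Q x) \<longleftrightarrow>
      (\<forall>x\<in>{a<..<b}. 0 \<le> (P' x * Q x - P x * Q' x) / (Q x * Q x))"
    by (rule mono_on_iff_deriv_nonneg)
  also have "\<dots> \<longleftrightarrow> (\<forall>x\<in>{a<..<b}. 0 \<le> P' x * Q x - P x * Q' x)"
  proof (rule ball_cong[OF refl])
    fix x assume "x \<in> {a<..<b}"
    then show "0 \<le> (P' x * Q x - P x * Q' x) / (Q x * Q x) \<longleftrightarrow> 0 \<le> P' x * Q x - P x * Q' x"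
      using pos_le_divide_eq[of "Q x * Q x" 0] pos[of x] by simp
  qed
  finally show ?thesis .
qed

section \<open>Non-negativity of quantiles\<close>

lemma quantile_nonneg:
  assumes "standing_assms M X f l u" "0 < p" "p < 1"
  shows "0 \<le> quantile M X p"
proof -
  interpret prob_space M
    using assms(1) by (simp add: standing_assms_def)
  have meas [measurable]: "X \<in> borel_measurable M" and nonneg: "AE \<omega> in M. 0 \<le> X \<omega>"
    using assms(1) by (auto simp: standing_assms_def distributed_def)
  interpret D: real_distribution "distr M borel X"
    using meas by (rule real_distribution_distr)
  have cdf_neg: "dist_fun M X x = 0" if "x < 0" for x
  proof -
    have "AE \<omega> in M. \<omega> \<notin> X -` {..x} \<inter> space M"
      using nonneg by eventually_elim (use that in auto)
    then show ?thesis
      by (simp add: cdf_def measure_distr prob_eq_0)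
  qed
  \<comment> \<open>The set under \<open>Inf\<close> must be non-empty for \<open>Inf\<close> to be
    its greatest lower bound; this is where \<open>p < 1\<close> enters.\<close>
  have "\<forall>\<^sub>F x in at_top. p < dist_fun M X x"
    using D.cdf_lim_at_top_prob \<open>p < 1\<close> by (rule order_tendstoD)
  then obtain x0 where "p \<le> dist_fun M X x0"
    by (auto simp: eventually_at_top_linorder intro: less_imp_le)
  have "0 \<le> x" if "p \<le> dist_fun M X x" for x
    using cdf_neg[of x] that \<open>0 < p\<close> by fastforce
  then show ?thesis
    unfolding quantile_def using \<open>p \<le> dist_fun M X x0\<close> by (intro cInf_greatest) auto
qed

section \<open>Calculus of two functions with a unimodal ratio of derivatives\<close>

text \<open>Probability is stripped away: \<open>a\<close> stands for \<open>1 / f\<close> along the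
  quantiles of \<open>X\<close>, and \<open>s\<close> for the mode. The derivative of
  \<open>B\<close> written as \<open>r p * a p\<close> encodes r = B' / A' without a
  division.\<close>

locale unimodal_derivative_ratio =
  fixes A B a r :: "real \<Rightarrow> real" and s :: real
  assumes A_deriv: "p \<in> {0<..<1} \<Longrightarrow> (A has_real_derivative a p) (at p)"
    and B_deriv: "p \<in> {0<..<1} \<Longrightarrow> (B has_real_derivative r p * a p) (at p)"
    and a_pos: "p \<in> {0<..<1} \<Longrightarrow> 0 < a p"
    and r_pos: "p \<in> {0<..<1} \<Longrightarrow> 0 < r p"
    and A_nonneg: "p \<in> {0<..<1} \<Longrightarrow> 0 \<le> A p"
    and B_nonneg: "p \<in> {0<..<1} \<Longrightarrow> 0 \<le> B p"
    and s: "0 < s" "s < 1"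
    and incr: "mono_on {0<..<s} r"
    and decr: "antimono_on {s<..<1} r"
begin

definition \<delta> :: "real \<Rightarrow> real" where
  "\<delta> p = A p * r p - B p"

lemma A_less: "A p < A q" if "0 < p" "p < q" "q < 1"
proof (rule DERIV_pos_imp_increasing[OF \<open>p < q\<close>])
  fix x assume "p \<le> x" "x \<le> q"
  then show "\<exists>y. (A has_real_derivative y) (at x) \<and> 0 < y"
    using that by (intro exI[of _ "a x"] conjI A_deriv a_pos) auto
qed

lemma B_less: "B p < B q" if "0 < p" "p < q" "q < 1"
proof (rule DERIV_pos_imp_increasing[OF \<open>p < q\<close>])
  fix x assume "p \<le> x" "x \<le> q"
  then show "\<exists>y. (B has_real_derivative y) (at x) \<and> 0 < y"
    using that by (intro exI[of _ "r x * a x"] conjI B_deriv mult_pos_pos a_pos r_pos) auto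
qed

lemma A_pos: "0 < A p" if "p \<in> {0<..<1}"
  \<comment> \<open>Strict increase turns non-negativity at \<open>p / 2\<close> into positivity at
    \<open>p\<close>, which makes the quotients below legitimate.\<close>
  using A_less[of "p / 2" p] A_nonneg[of "p / 2"] that by auto

lemma B_pos: "0 < B p" if "p \<in> {0<..<1}"
  using B_less[of "p / 2" p] B_nonneg[of "p / 2"] that by auto

lemma cauchy_mvt:
  assumes "0 < p" "p < q" "q < 1"
  obtains c where "p < c" "c < q" "B q - B p = r c * (A q - A p)"
proof -
  have "\<exists>c. p < c \<and> c < q \<and> (B q - B p) * a c = (A q - A p) * (r c * a c)"
  proof (rule GMVT'[OF \<open>p < q\<close>])
    fix z assume "p \<le> z" "z \<le> q"
    then have "z \<in> {0<..<1}"
      using assms by auto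
    then show "isCont A z" "isCont B z"
      using A_deriv B_deriv by (blast intro: DERIV_isCont)+
  qed (use assms in \<open>auto intro!: A_deriv B_deriv\<close>)
  then obtain c where "p < c" "c < q" "(B q - B p) * a c = (A q - A p) * (r c * a c)"
    by blast
  moreover have "a c \<noteq> 0"
    using a_pos[of c] assms calculation by auto
  ultimately show thesis
    by (intro that[of c]) (auto simp: mult.commute)
qed

lemma deriv_diff:
  "((\<lambda>x. B x - k * A x) has_real_derivative (r p - k) * a p) (at p)" if "p \<in> {0<..<1}"
  using DERIV_diff[OF B_deriv[OF that] DERIV_cmult[OF A_deriv[OF that], of k]]
  by (simp add: left_diff_distrib)

text \<open>If \<open>r p\<close> exceeded \<open>r s\<close>, then \<open>B - r p * A\<close> would
  have negative derivative at \<open>s\<close> and hence drop just before \<open>s\<close>; but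
  \<open>r\<close> is at least \<open>r p\<close> on \<open>(p, s)\<close>, so by Cauchy's theorem
  it cannot drop there.\<close>

lemma r_le_at_mode_left: "r p \<le> r s" if p: "0 < p" "p < s"
proof (rule ccontr)
  assume "\<not> r p \<le> r s"
  then have "(r s - r p) * a s < 0"
    using a_pos[of s] s by (simp add: mult_neg_pos)
  from DERIV_neg_dec_left[OF deriv_diff this] s
  obtain d where d: "d > 0" "\<And>h. \<lbrakk>0 < h; h < d\<rbrakk> \<Longrightarrow> B s - r p * A s < B (s - h) - r p * A (s - h)"
    by auto
  \<comment> \<open>Halving the minimum puts \<open>q\<close> strictly between \<open>p\<close> and
    \<open>s\<close> and within \<open>d\<close> of \<open>s\<close>.\<close>
  define q where "q = s - min d (s - p) / 2"
  have q: "p < q" "q < s" "s - q < d"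
    using d p by (auto simp: q_def min_def field_simps)
  obtain c where c: "q < c" "c < s" "B s - B q = r c * (A s - A q)"
    using cauchy_mvt[of q s] q p s by auto
  have "r p * (A s - A q) \<le> r c * (A s - A q)"
    using mono_onD[OF incr, of p c] A_less[of q s] q c p s by (intro mult_right_mono) auto
  then show False
    using d(2)[of "s - q"] q c by (simp add: algebra_simps)
qed

text \<open>Mirror image: \<open>B - r p * A\<close> would drop just after \<open>s\<close>,
  although \<open>r\<close> is at least \<open>r p\<close> on \<open>(s, p)\<close>.\<close>

lemma r_le_at_mode_right: "r p \<le> r s" if p: "s < p" "p < 1"
proof (rule ccontr)
  assume "\<not> r p \<le> r s"
  then have "(r s - r p) * a s < 0"
    using a_pos[of s] s by (simp add: mult_neg_pos)
  from DERIV_neg_dec_right[OF deriv_diff this] s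
  obtain d where d: "d > 0" "\<And>h. \<lbrakk>0 < h; h < d\<rbrakk> \<Longrightarrow> B (s + h) - r p * A (s + h) < B s - r p * A s"
    by auto
  define q where "q = s + min d (p - s) / 2"
  have q: "q < p" "s < q" "q - s < d"
    using d p by (auto simp: q_def min_def field_simps)
  obtain c where c: "s < c" "c < q" "B q - B s = r c * (A q - A s)"
    using cauchy_mvt[of s q] q p s by auto
  have "r p * (A q - A s) \<le> r c * (A q - A s)"
    using monotone_onD[OF decr, of c p] A_less[of s q] q c p s by (intro mult_right_mono) auto
  then show False
    using d(2)[of "q - s"] q c by (simp add: algebra_simps)
qed

lemma r_mono: "r p \<le> r q" if "0 < p" "p \<le> q" "q \<le> s"
proof (cases "q = s")
  case True
  then show ?thesis
    using that r_le_at_mode_left[of p] by (cases "p = s") auto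
next
  case False
  with that show ?thesis
    by (intro mono_onD[OF incr]) auto
qed

lemma r_antimono: "r q \<le> r p" if "s \<le> p" "p \<le> q" "q < 1"
proof (cases "p = s")
  case True
  then show ?thesis
    using that r_le_at_mode_right[of q] by (cases "q = s") auto
next
  case False
  with that show ?thesis
    by (intro monotone_onD[OF decr]) auto
qed

text \<open>With \<open>c\<close> from Cauchy's theorem, \<open>\<delta> q - \<delta> p = A p * (r q
  - r p) + (r q - r c) * (A q - A p)\<close>, and both summands are non-negative to the left of the
  mode.\<close>

lemma \<delta>_mono: "\<delta> p \<le> \<delta> q" if p: "0 < p" "p \<le> q" "q \<le> s"
proof (cases "p = q")
  case False
  obtain c where c: "p < c" "c < q" "B q - B p = r c * (A q - A p)"
    using cauchy_mvt[of p q] p False s by auto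
  have "r c * (A q - A p) \<le> r q * (A q - A p)"
    using r_mono[of c q] A_less[of p q] c p s by (intro mult_right_mono) auto
  moreover have "A p * r p \<le> A p * r q"
    using r_mono[of p q] A_pos[of p] p s by (intro mult_left_mono) auto
  ultimately show ?thesis
    using c by (simp add: \<delta>_def algebra_simps)
qed simp

text \<open>The same decomposition, now with both summands non-positive.\<close>

lemma \<delta>_antimono: "\<delta> q \<le> \<delta> p" if p: "s \<le> p" "p \<le> q" "q < 1"
proof (cases "p = q")
  case False
  obtain c where c: "p < c" "c < q" "B q - B p = r c * (A q - A p)"
    using cauchy_mvt[of p q] p False s by auto
  have "r q * (A q - A p) \<le> r c * (A q - A p)"
    using r_antimono[of c q] A_less[of p q] c p s by (intro mult_right_mono) auto
  moreover have "A p * r q \<le> A p * r p"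
    using r_antimono[of p q] A_pos[of p] p s by (intro mult_left_mono) auto
  ultimately show ?thesis
    using c by (simp add: \<delta>_def algebra_simps)
qed simp

lemma mono_on_B_div_A_iff: "mono_on {0<..<1} (\<lambda>p. B p / A p) \<longleftrightarrow> (\<forall>p\<in>{0<..<1}. 0 \<le> \<delta> p)"
proof -
  have "0 \<le> r p * a p * A p - B p * a p \<longleftrightarrow> 0 \<le> \<delta> p" if "p \<in> {0<..<1}" for p
  proof -
    have "r p * a p * A p - B p * a p = a p * \<delta> p"
      by (simp add: \<delta>_def algebra_simps)
    then show ?thesis
      using a_pos[OF that] by (simp only: zero_le_mult_iff) auto
  qed
  then show ?thesis
    using mono_on_divide_iff[of 0 1 B "\<lambda>p. r p * a p" A a] A_deriv B_deriv A_pos by blast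
qed

lemma mono_on_A_div_B_iff: "mono_on {0<..<1} (\<lambda>p. A p / B p) \<longleftrightarrow> \<delta> s \<le> 0"
proof -
  have "0 \<le> a p * B p - A p * (r p * a p) \<longleftrightarrow> \<delta> p \<le> 0" if "p \<in> {0<..<1}" for p
  proof -
    have "a p * B p - A p * (r p * a p) = a p * - \<delta> p"
      by (simp add: \<delta>_def algebra_simps)
    then show ?thesis
      using a_pos[OF that] by (simp only: zero_le_mult_iff) auto
  qed
  then have "mono_on {0<..<1} (\<lambda>p. A p / B p) \<longleftrightarrow> (\<forall>p\<in>{0<..<1}. \<delta> p \<le> 0)"
    using mono_on_divide_iff[of 0 1 A a B "\<lambda>p. r p * a p"] A_deriv B_deriv B_pos by blast
  also have "\<dots> \<longleftrightarrow> \<delta> s \<le> 0"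
  proof
    assume "\<delta> s \<le> 0"
    moreover have "\<delta> p \<le> \<delta> s" if "p \<in> {0<..<1}" for p
      using \<delta>_mono[of p s] \<delta>_antimono[of s p] that by (cases "p \<le> s") auto
    ultimately show "\<forall>p\<in>{0<..<1}. \<delta> p \<le> 0"
      by force
  qed (use s in auto)
  finally show ?thesis .
qed

text \<open>Limits at a non-trivial filter are unique, so the existential form asserts existence of
  the limits together with the criterion for their values. They are the infima of
  \<open>\<delta>\<close> over the two sides of \<open>s\<close>.\<close>

lemma \<delta>_nonneg_iff_limits:
  "\<exists>L0 L1 :: ereal.
     ((\<lambda>p. ereal (\<delta> p)) \<longlongrightarrow> L0) (at_right 0) \<and>
     ((\<lambda>p. ereal (\<delta> p)) \<longlongrightarrow> L1) (at_left 1) \<and>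
     ((\<forall>p\<in>{0<..<1}. 0 \<le> \<delta> p) \<longleftrightarrow> 0 \<le> L0 \<and> 0 \<le> L1)"
proof (intro exI conjI)
  show "((\<lambda>p. ereal (\<delta> p)) \<longlongrightarrow> (INF p\<in>{0<..<s}. ereal (\<delta> p))) (at_right 0)"
    using s by (intro mono_on_tendsto_at_right_INF mono_onI) (auto intro: \<delta>_mono)
  show "((\<lambda>p. ereal (\<delta> p)) \<longlongrightarrow> (INF p\<in>{s<..<1}. ereal (\<delta> p))) (at_left 1)"
    using s by (intro antimono_on_tendsto_at_left_INF monotone_onI) (auto intro: \<delta>_antimono)
  \<comment> \<open>The point \<open>s\<close> lies in neither open half; its sign is inherited from
    \<open>s / 2\<close>.\<close>
  have "0 \<le> \<delta> s" if "\<forall>p\<in>{0<..<s}. 0 \<le> \<delta> p"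
  proof -
    have "0 \<le> \<delta> (s / 2)"
      using that s by simp
    also have "\<dots> \<le> \<delta> s"
      using s by (intro \<delta>_mono) auto
    finally show ?thesis .
  qed
  moreover have "{0<..<1} = {0<..<s} \<union> {s} \<union> {s<..<1}"
    using s by auto
  ultimately have "(\<forall>p\<in>{0<..<1}. 0 \<le> \<delta> p) \<longleftrightarrow>
      (\<forall>p\<in>{0<..<s}. 0 \<le> \<delta> p) \<and> (\<forall>p\<in>{s<..<1}. 0 \<le> \<delta> p)"
    by (simp only: ball_Un) blast
  then show "(\<forall>p\<in>{0<..<1}. 0 \<le> \<delta> p) \<longleftrightarrow>
      0 \<le> (INF p\<in>{0<..<s}. ereal (\<delta> p)) \<and> 0 \<le> (INF p\<in>{s<..<1}. ereal (\<delta> p))"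
    by (simp add: le_INF_iff)
qed

end

section \<open>Transfer to quantile functions\<close>

theorem theorem2p5:
  fixes M :: "'a measure" and N :: "'b measure"
    and X :: "'a \<Rightarrow> real" and Y :: "'b \<Rightarrow> real"
    and f g :: "real \<Rightarrow> real"
    and lX uX lY uY :: ereal
    and pstar :: real
    and ratio \<delta> :: "real \<Rightarrow> real"
  assumes X: "standing_assms M X f lX uX"
    and Y: "standing_assms N Y g lY uY"
    and ratio: "\<And>p. ratio p = f (quantile M X p) / g (quantile N Y p)"
    and pstar: "0 < pstar" "pstar < 1"
    and incr: "mono_on {0<..<pstar} ratio"
    and decr: "antimono_on {pstar<..<1} ratio"
    and \<delta>: "\<And>p. \<delta> p = quantile M X p * ratio p - quantile N Y p"
  shows "(\<exists>L0 L1 :: ereal.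
            ((\<lambda>p. ereal (\<delta> p)) \<longlongrightarrow> L0) (at_right 0) \<and>
            ((\<lambda>p. ereal (\<delta> p)) \<longlongrightarrow> L1) (at_left 1) \<and>
            (star_le M X N Y \<longleftrightarrow> 0 \<le> L0 \<and> 0 \<le> L1)) \<and>
         (star_le N Y M X \<longleftrightarrow> \<delta> pstar \<le> 0)"
proof -
  have f: "0 < f (quantile M X p)"
      "(quantile M X has_real_derivative 1 / f (quantile M X p)) (at p)"
    and g: "0 < g (quantile N Y p)"
      "(quantile N Y has_real_derivative 1 / g (quantile N Y p)) (at p)"
    if "p \<in> {0<..<1}" for p
    using X Y that by (auto simp: standing_assms_def)
  interpret U: unimodal_derivative_ratio
    "quantile M X" "quantile N Y" "\<lambda>p. 1 / f (quantile M X p)" ratio pstar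
  proof
    fix p :: real assume p: "p \<in> {0<..<1}"
    \<comment> \<open>Since \<open>f\<close> is positive at the quantile, it cancels and leaves
      \<open>1 / g\<close>.\<close>
    show "(quantile N Y has_real_derivative ratio p * (1 / f (quantile M X p))) (at p)"
      using f(1)[OF p] g(2)[OF p] by (simp add: ratio)
    show "0 \<le> quantile M X p" "0 \<le> quantile N Y p"
      using p quantile_nonneg X Y by fastforce+
  qed (use f g pstar incr decr in \<open>simp_all add: ratio\<close>)
  have "U.\<delta> = \<delta>"
    by (simp add: fun_eq_iff U.\<delta>_def \<delta>)
  then show ?thesis
    using U.\<delta>_nonneg_iff_limits U.mono_on_B_div_A_iff U.mono_on_A_div_B_iff
    by (simp add: star_le_def)
qed

end
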